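(* Let $L\ge1$ be an integer and, for $\nu>0$, let $T_{L,0}(\nu)$ be the first-passage time from state $L$ to state $0$ of the birth-and-death process $(X_t)_{t\ge0}$ on $\{0,1,\dots,L\}$ with transition rates $q(l,l+1)=(L-l)\nu$ for $0\le l\le L-1$ and $q(l,l-1)=l$ for $1\le l\le L$. Then $$\frac{T_{L,0}(\nu)}{\mathbb{E}\,T_{L,0}(\nu)}\xrightarrow{d}\mathrm{Exp}(1),\qquad\nu\to\infty .$$
   Context: $T_{L,0}(\nu)=\inf\{t>0:X_t=0\}$ given $X_0=L$. $\mathrm{Exp}(\lambda)$ denotes an exponentially distributed random variable with mean $1/\lambda$, and $\xrightarrow{d}$ denotes convergence in distribution. *)

theory Defs
  imports "HOL-Probability.Probability"
begin

definition transition_function :: "'s set \<Rightarrow> (real \<Rightarrow> 's \<Rightarrow> 's \<Rightarrow> real) \<Rightarrow> bool" where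
  "transition_function S P \<longleftrightarrow>
     (\<forall>t\<ge>0. \<forall>i\<in>S. (\<forall>j\<in>S. 0 \<le> P t i j) \<and> (\<Sum>j\<in>S. P t i j) = 1) \<and>
     (\<forall>i\<in>S. \<forall>j\<in>S. P 0 i j = (if i = j then 1 else 0)) \<and>
     (\<forall>s\<ge>0. \<forall>t\<ge>0. \<forall>i\<in>S. \<forall>j\<in>S. P (s + t) i j = (\<Sum>k\<in>S. P s i k * P t k j))"

(* Only off-diagonal rates are prescribed: on a finite state space stochasticity
   forces (1 - P h i i) / h to converge to the sum of q i j over j \<noteq> i. *)
definition has_transition_rates ::
    "'s set \<Rightarrow> (real \<Rightarrow> 's \<Rightarrow> 's \<Rightarrow> real) \<Rightarrow> ('s \<Rightarrow> 's \<Rightarrow> real) \<Rightarrow> bool" where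
  "has_transition_rates S P q \<longleftrightarrow>
     (\<forall>i\<in>S. \<forall>j\<in>S. i \<noteq> j \<longrightarrow> ((\<lambda>h. P h i j / h) \<longlongrightarrow> q i j) (at_right 0))"

(* The Markov property is stated in product form, through the finite-dimensional
   distributions, so that conditioning events of probability zero need no special
   treatment. The index of X is meaningful for t \<ge> 0 only. Right continuity is with
   respect to the discrete topology on S. *)
locale finite_markov_jump_process = prob_space M
  for M :: "'a measure" +
  fixes S :: "'s set" and q :: "'s \<Rightarrow> 's \<Rightarrow> real" and X :: "real \<Rightarrow> 'a \<Rightarrow> 's"
  assumes finite_states: "finite S"
    and measurable_process: "\<And>t. 0 \<le> t \<Longrightarrow> X t \<in> measurable M (count_space S)"
    and right_continuous_paths:
      "\<And>\<omega> t. \<omega> \<in> space M \<Longrightarrow> 0 \<le> t \<Longrightarrow> eventually (\<lambda>s. X s \<omega> = X t \<omega>) (at_right t)"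
    and markov_with_rates:
      "\<exists>P. transition_function S P \<and> has_transition_rates S P q \<and>
         (\<forall>(n::nat) t x. 0 \<le> t 0 \<longrightarrow> (\<forall>k<n. t k < t (Suc k)) \<longrightarrow> (\<forall>k\<le>n. x k \<in> S) \<longrightarrow>
            prob {\<omega> \<in> space M. \<forall>k\<le>n. X (t k) \<omega> = x k} =
            prob {\<omega> \<in> space M. X (t 0) \<omega> = x 0} *
              (\<Prod>k<n. P (t (Suc k) - t k) (x k) (x (Suc k))))"

definition bd_rate :: "nat \<Rightarrow> real \<Rightarrow> nat \<Rightarrow> nat \<Rightarrow> real" where
  "bd_rate L \<nu> i j =
     (if i < L \<and> j = i + 1 then real (L - i) * \<nu>
      else if 1 \<le> i \<and> i \<le> L \<and> j + 1 = i then real i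
      else 0)"

definition birth_death_process_from ::
    "nat \<Rightarrow> 'a measure \<Rightarrow> nat \<Rightarrow> real \<Rightarrow> (real \<Rightarrow> 'a \<Rightarrow> nat) \<Rightarrow> bool" where
  "birth_death_process_from x0 M L \<nu> X \<longleftrightarrow>
     finite_markov_jump_process M {0..L} (bd_rate L \<nu>) X \<and> (AE \<omega> in M. X 0 \<omega> = x0)"

(* Valued in ennreal, so that the infimum of the empty set is infinite. *)
definition first_passage_time :: "(real \<Rightarrow> 'a \<Rightarrow> 's) \<Rightarrow> 's \<Rightarrow> 'a \<Rightarrow> ennreal" where
  "first_passage_time X y \<omega> = (INF t\<in>{t. 0 < t \<and> X t \<omega> = y}. ennreal t)"

(* Law of T / E T on the reals. The conversion enn2real sends the value infinity to 0,
   but this cannot hide anything: if T is infinite with positive probability, or merely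
   not integrable, then E T is infinite and T / E T is 0 wherever T is finite, so the law
   is the point mass at 0. *)
definition normalised_law :: "'a measure \<Rightarrow> ('a \<Rightarrow> ennreal) \<Rightarrow> real measure" where
  "normalised_law M T = distr M borel (\<lambda>\<omega>. enn2real (T \<omega> / (\<integral>\<^sup>+\<omega>'. T \<omega>' \<partial>M)))"

definition exponential_law :: "real \<Rightarrow> real measure" where
  "exponential_law l = density lborel (\<lambda>x. ennreal (exponential_density l x))"

(* The library's weak_conv_m covers sequences only; this is the same notion along an
   arbitrary filter. *)
definition weak_conv_along :: "'i filter \<Rightarrow> ('i \<Rightarrow> real measure) \<Rightarrow> real measure \<Rightarrow> bool" where
  "weak_conv_along F \<mu> \<mu>' \<longleftrightarrow>
     (\<forall>x. isCont (cdf \<mu>') x \<longrightarrow> ((\<lambda>i. cdf (\<mu> i) x) \<longlongrightarrow> cdf \<mu>' x) F)"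

lemma weak_conv_along_sequentially: "weak_conv_along sequentially \<mu> \<mu>' \<longleftrightarrow> weak_conv_m \<mu> \<mu>'"
  by (simp add: weak_conv_along_def weak_conv_m_def weak_conv_def)

end

theory Submission
  imports Defs
begin

text \<open>For large \<open>\<nu>\<close> the chain returns to its typical high levels many times before it reaches 0, so it
forgets where it started and the hitting time \<open>T\<close> of 0 loses memory. The proof expresses this
through means only. Let \<open>u l\<close> be the mean of \<open>T\<close> started from \<open>l\<close>, that is, the solution of the
Poisson equation \<open>Q u = -1\<close> off 0 with \<open>u 0 = 0\<close>. By Dynkin's formula the mean \<open>f t\<close> of \<open>u (X t)\<close>
on the event \<open>T > t\<close> has derivative \<open>-G t\<close>, where \<open>G t\<close> is the probability of \<open>T > t\<close>. If
\<open>a \<le> u \<le> b\<close> off 0, then \<open>f\<close> lies between \<open>a * G\<close> and \<open>b * G\<close>, so \<open>f\<close> decays at a rate between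
\<open>1 / b\<close> and \<open>1 / a\<close>, and
\<open>a / b * exp (- t / a) \<le> G t \<le> b / a * exp (- t / b)\<close> (lemma \<open>survival_bounds\<close>).

Since the process is given through its finite-dimensional distributions, the argument is carried
out on time grids (\<open>grid_survival_bounds\<close>), where it becomes a geometric recursion, and right
continuity of the paths identifies the limit along dyadic grids
(\<open>prob_dyadic_avoids_tendsto\<close>). Integrating the bounds on \<open>G\<close> confines the mean of \<open>T\<close> as well, so
that the distribution function of the normalised time lies between two functions depending on
\<open>c = b / a\<close> alone, which both tend to \<open>1 - exp (- x)\<close> as \<open>c\<close> tends to 1
(\<open>cdf_normalised_first_passage_bounds\<close>).

It remains to see that \<open>u\<close> becomes flat. It is the sum of the mean descents from one level to the
next; the descent from 1 to 0 dominates all others by a factor of order \<open>\<nu>\<close>, which allows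
\<open>c = 1 + L\<^sup>2 / \<nu>\<close> (\<open>hitting_mean_bounds\<close>).
\<close>

section \<open>One-step estimates\<close>

lemma sum_PiE_atMost_Suc:
  "(\<Sum>x\<in>PiE {..Suc n} (\<lambda>_. A). g x) = (\<Sum>x\<in>PiE {..n} (\<lambda>_. A). \<Sum>j\<in>A. g (x(Suc n := j)))"
proof -
  have "(\<Sum>x\<in>PiE {..Suc n} (\<lambda>_. A). g x) = (\<Sum>p\<in>A \<times> PiE {..n} (\<lambda>_. A). g ((snd p)(Suc n := fst p)))"
    unfolding atMost_Suc PiE_insert_eq
    by (subst sum.reindex[OF inj_combinator]) (auto simp: case_prod_unfold)
  also have "\<dots> = (\<Sum>j\<in>A. \<Sum>x\<in>PiE {..n} (\<lambda>_. A). g (x(Suc n := j)))"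
    by (simp add: sum.cartesian_product case_prod_unfold)
  also have "\<dots> = (\<Sum>x\<in>PiE {..n} (\<lambda>_. A). \<Sum>j\<in>A. g (x(Suc n := j)))"
    by (rule sum.swap)
  finally show ?thesis .
qed

text \<open>Dynkin's formula to first order: over a time step \<open>h\<close> the mean of \<open>u\<close> decreases by
\<open>h + o(h)\<close>. Since the rows of \<open>P h\<close> sum to 1, the value \<open>u i\<close> can be subtracted inside the
sum, after which only off-diagonal entries of \<open>P h\<close>, whose rates are prescribed, remain.\<close>
lemma one_step_generator_estimate:
  assumes "finite S" and tf: "transition_function S P" and rates: "has_transition_rates S P q"
    and drift: "\<And>i. i \<in> A \<Longrightarrow> (\<Sum>j\<in>S - {i}. q i j * (u j - u i)) = - 1"
    and "A \<subseteq> S" and "0 < \<delta>"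
  shows "\<forall>\<^sub>F h in at_right 0. \<forall>i\<in>A. \<bar>(\<Sum>j\<in>S. P h i j * u j) - u i + h\<bar> \<le> \<delta> * h"
proof -
  have "\<forall>\<^sub>F h in at_right 0. \<bar>(\<Sum>j\<in>S. P h i j * u j) - u i + h\<bar> \<le> \<delta> * h" if i: "i \<in> A" for i
  proof -
    have iS: "i \<in> S" using i \<open>A \<subseteq> S\<close> by auto
    have "((\<lambda>h. \<Sum>j\<in>S - {i}. P h i j / h * (u j - u i)) \<longlongrightarrow> (\<Sum>j\<in>S - {i}. q i j * (u j - u i))) (at_right 0)"
      using rates iS by (intro tendsto_sum tendsto_mult tendsto_const) (auto simp: has_transition_rates_def)
    then have "\<forall>\<^sub>F h in at_right 0. dist (\<Sum>j\<in>S - {i}. P h i j / h * (u j - u i)) (- 1) < \<delta>"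
      using \<open>0 < \<delta>\<close> unfolding drift[OF i] by (rule tendstoD)
    then show ?thesis
      using eventually_at_right_less[of "0::real"]
    proof eventually_elim
      case (elim h)
      have row: "(\<Sum>j\<in>S. P h i j) = 1"
        using tf iS elim by (auto simp: transition_function_def)
      have "(\<Sum>j\<in>S. P h i j * u j) - u i = (\<Sum>j\<in>S. P h i j * u j) - (\<Sum>j\<in>S. P h i j) * u i"
        by (simp add: row)
      also have "\<dots> = (\<Sum>j\<in>S. P h i j * (u j - u i))"
        by (simp add: sum_distrib_right sum_subtractf right_diff_distrib)
      also have "\<dots> = (\<Sum>j\<in>S - {i}. P h i j * (u j - u i))"
        by (subst sum.remove[OF \<open>finite S\<close> iS]) simp
      also have "\<dots> = h * (\<Sum>j\<in>S - {i}. P h i j / h * (u j - u i))"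
        unfolding sum_distrib_left using elim by (intro sum.cong) auto
      finally have "(\<Sum>j\<in>S. P h i j * u j) - u i + h
          = h * ((\<Sum>j\<in>S - {i}. P h i j / h * (u j - u i)) + 1)"
        by (simp add: algebra_simps)
      moreover have "\<bar>h * ((\<Sum>j\<in>S - {i}. P h i j / h * (u j - u i)) + 1)\<bar> \<le> h * \<delta>"
        unfolding abs_mult using elim by (intro mult_mono) (auto simp: dist_real_def)
      ultimately show ?case by (simp add: mult.commute)
    qed
  qed
  then show ?thesis
    using finite_subset[OF \<open>A \<subseteq> S\<close> \<open>finite S\<close>] by (simp add: eventually_ball_finite)
qed

text \<open>The intended reading is \<open>g n\<close> = probability of survival for \<open>n\<close> steps and \<open>f n\<close> = mean of
\<open>u\<close> on that event. The sequence \<open>f\<close> decreases by about \<open>h * g n\<close> per step, and comparing \<open>g\<close>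
with \<open>f\<close> turns this into two geometric recursions. The smallness conditions keep both
ratios nonnegative, so that the inequalities can be iterated.\<close>
lemma discrete_gronwall_sandwich:
  fixes f g :: "nat \<Rightarrow> real"
  assumes a: "0 < a" and b: "0 < b" and h: "0 \<le> h" and d: "0 \<le> \<delta>" "\<delta> \<le> 1" and small: "h * (1 + \<delta>) \<le> a" "h * (1 - \<delta>) \<le> b"
    and ag: "\<And>n. a * g n \<le> f n" and bg: "\<And>n. f n \<le> b * g n"
    and step: "\<And>n. \<bar>f (Suc n) - f n + h * g n\<bar> \<le> \<delta> * h * g n"
  shows "f 0 * (1 - h * (1 + \<delta>) / a) ^ n \<le> f n" "f n \<le> f 0 * (1 - h * (1 - \<delta>) / b) ^ n"
proof -
  have lo: "f n * (1 - h * (1 + \<delta>) / a) \<le> f (Suc n)" for n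
  proof -
    have "g n \<le> f n / a" using ag[of n] a by (simp add: field_simps)
    then have "h * (1 + \<delta>) * g n \<le> h * (1 + \<delta>) * (f n / a)" using h d by (intro mult_left_mono) auto
    then show ?thesis using step[of n] by (simp add: algebra_simps add_divide_distrib diff_divide_distrib abs_le_iff)
  qed
  have up: "f (Suc n) \<le> f n * (1 - h * (1 - \<delta>) / b)" for n
  proof -
    have "f n / b \<le> g n" using bg[of n] b by (simp add: field_simps)
    then have "h * (1 - \<delta>) * (f n / b) \<le> h * (1 - \<delta>) * g n" using h d by (intro mult_left_mono) auto
    then show ?thesis using step[of n] by (simp add: algebra_simps add_divide_distrib diff_divide_distrib abs_le_iff)
  qed
  show "f 0 * (1 - h * (1 + \<delta>) / a) ^ n \<le> f n"
  proof (induction n)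
    case (Suc n)
    then have "f 0 * (1 - h * (1 + \<delta>) / a) ^ n * (1 - h * (1 + \<delta>) / a) \<le> f n * (1 - h * (1 + \<delta>) / a)"
      using small a by (intro mult_right_mono) (auto simp: field_simps)
    then show ?case using lo[of n] by (simp add: ac_simps)
  qed simp
  show "f n \<le> f 0 * (1 - h * (1 - \<delta>) / b) ^ n"
  proof (induction n)
    case (Suc n)
    then have "f n * (1 - h * (1 - \<delta>) / b) \<le> f 0 * (1 - h * (1 - \<delta>) / b) ^ n * (1 - h * (1 - \<delta>) / b)"
      using small b by (intro mult_right_mono) (auto simp: field_simps)
    then show ?case using up[of n] by (simp add: ac_simps)
  qed simp
qed

section \<open>The process observed on a time grid\<close>

context finite_markov_jump_process
begin

definition avoids :: "'s \<Rightarrow> real \<Rightarrow> nat \<Rightarrow> 'a set" where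
  "avoids y h n = {\<omega> \<in> space M. \<forall>k\<le>n. X (real k * h) \<omega> \<noteq> y}"

definition follows :: "real \<Rightarrow> nat \<Rightarrow> (nat \<Rightarrow> 's) \<Rightarrow> 'a set" where
  "follows h n x = {\<omega> \<in> space M. \<forall>k\<le>n. X (real k * h) \<omega> = x k}"

lemma X_in_states: "\<omega> \<in> space M \<Longrightarrow> 0 \<le> t \<Longrightarrow> X t \<omega> \<in> S"
  using measurable_space[OF measurable_process] by (simp add: space_count_space)

lemma pred_X [measurable]: "0 \<le> t \<Longrightarrow> Measurable.pred M (\<lambda>\<omega>. X t \<omega> = y)"
proof -
  assume t: "0 \<le> t"
  have "(\<lambda>\<omega>. (\<lambda>s. s = y) (X t \<omega>)) \<in> measurable M (count_space UNIV)"
    by (rule measurable_compose[OF measurable_process[OF t]]) simp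
  then show ?thesis by simp
qed

lemma avoids_sets: "0 \<le> h \<Longrightarrow> avoids y h n \<in> events"
  unfolding avoids_def by measurable

lemma follows_sets: "0 \<le> h \<Longrightarrow> follows h n x \<in> events"
  unfolding follows_def by measurable

lemma prob_avoids_eq_sum_paths:
  assumes "0 \<le> h"
  shows "prob (avoids y h n) = (\<Sum>x\<in>PiE {..n} (\<lambda>_. S - {y}). prob (follows h n x))"
proof -
  have "avoids y h n = (\<Union>x\<in>PiE {..n} (\<lambda>_. S - {y}). follows h n x)"
  proof (intro set_eqI iffI)
    fix \<omega> assume w: "\<omega> \<in> avoids y h n"
    let ?x = "restrict (\<lambda>k. X (real k * h) \<omega>) {..n}"
    have "?x \<in> PiE {..n} (\<lambda>_. S - {y})" "\<omega> \<in> follows h n ?x"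
      using w assms X_in_states by (auto simp: avoids_def follows_def)
    then show "\<omega> \<in> (\<Union>x\<in>PiE {..n} (\<lambda>_. S - {y}). follows h n x)" by blast
  next
    fix \<omega> assume "\<omega> \<in> (\<Union>x\<in>PiE {..n} (\<lambda>_. S - {y}). follows h n x)"
    then show "\<omega> \<in> avoids y h n" by (fastforce simp: avoids_def follows_def PiE_iff)
  qed
  moreover have "disjoint_family_on (follows h n) (PiE {..n} (\<lambda>_. S - {y}))"
    unfolding disjoint_family_on_def
  proof (intro ballI impI)
    fix x x' assume x: "x \<in> PiE {..n} (\<lambda>_. S - {y})" "x' \<in> PiE {..n} (\<lambda>_. S - {y})" "x \<noteq> x'"
    then obtain k where "k \<le> n" "x k \<noteq> x' k" by (metis PiE_ext atMost_iff)
    then show "follows h n x \<inter> follows h n x' = {}" by (auto simp: follows_def)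
  qed
  ultimately show ?thesis
    using finite_states assms
    by (auto intro!: finite_measure_finite_Union finite_PiE follows_sets)
qed

text \<open>Decomposing over the finitely many grid paths that avoid \<open>y\<close>, the product form of the Markov
property lets the last step be averaged with \<open>P h\<close>. Because \<open>u\<close> vanishes at \<open>y\<close>, paths that
enter \<open>y\<close> contribute nothing to that average, so the one-step estimate, whose sum
runs over all of \<open>S\<close>, is the recursion required by \<open>discrete_gronwall_sandwich\<close>.\<close>
lemma grid_survival_bounds:
  assumes a: "0 < a" and drift: "\<And>i. i \<in> S - {y} \<Longrightarrow> (\<Sum>j\<in>S - {i}. q i j * (u j - u i)) = - 1"
    and uy: "u y = 0" and u: "\<And>i. i \<in> S - {y} \<Longrightarrow> a \<le> u i \<and> u i \<le> b" and ab: "a \<le> b"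
    and start: "AE \<omega> in M. X 0 \<omega> \<noteq> y" and d: "0 < \<delta>" "\<delta> \<le> 1"
  shows "\<forall>\<^sub>F h in at_right 0. \<forall>n.
     a / b * (1 - h * (1 + \<delta>) / a) ^ n \<le> prob (avoids y h n) \<and>
     prob (avoids y h n) \<le> b / a * (1 - h * (1 - \<delta>) / b) ^ n"
proof -
  obtain P where tf: "transition_function S P" and rates: "has_transition_rates S P q"
    and markov: "\<And>(n::nat) t x. 0 \<le> t 0 \<Longrightarrow> (\<forall>k<n. t k < t (Suc k)) \<Longrightarrow> (\<forall>k\<le>n. x k \<in> S) \<Longrightarrow>
            prob {\<omega> \<in> space M. \<forall>k\<le>n. X (t k) \<omega> = x k} =
            prob {\<omega> \<in> space M. X (t 0) \<omega> = x 0} *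
              (\<Prod>k<n. P (t (Suc k) - t k) (x k) (x (Suc k)))"
    using markov_with_rates by blast
  have b: "0 < b" using a ab by simp
  let ?A = "S - {y}"
  have "\<forall>\<^sub>F h in at_right 0. \<forall>i\<in>?A. \<bar>(\<Sum>j\<in>S. P h i j * u j) - u i + h\<bar> \<le> \<delta> * h"
    using finite_states tf rates drift d by (intro one_step_generator_estimate) auto
  \<comment> \<open>As \<open>\<delta> \<le> 1\<close>, this makes \<open>h * (1 + \<delta>)\<close> at most \<open>a\<close>.\<close>
  moreover have "\<forall>\<^sub>F h in at_right 0. h < a / 2"
    using eventually_at_right_real[of 0 "a / 2"] a by (auto elim: eventually_mono)
  moreover have "\<forall>\<^sub>F h::real in at_right 0. 0 < h" by (rule eventually_at_right_less)
  ultimately show ?thesis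
  proof eventually_elim
    case (elim h)
    define p where "p n x = prob (follows h n x)" for n x
    define g where "g n = prob (avoids y h n)" for n
    define f where "f n = (\<Sum>x\<in>PiE {..n} (\<lambda>_. ?A). p n x * u (x n))" for n
    have g_sum: "g n = (\<Sum>x\<in>PiE {..n} (\<lambda>_. ?A). p n x)" for n
      unfolding g_def p_def using elim by (intro prob_avoids_eq_sum_paths) auto
    have p_nn: "0 \<le> p n x" for n x by (simp add: p_def)
    \<comment> \<open>One more step multiplies the weight of a path by a single transition probability.\<close>
    have p_Suc: "p (Suc n) (x(Suc n := j)) = p n x * P h (x n) j"
      if x: "x \<in> PiE {..n} (\<lambda>_. ?A)" and j: "j \<in> ?A" for n x j
    proof -
      have m: "prob (follows h m z) = prob {\<omega> \<in> space M. X 0 \<omega> = z 0} * (\<Prod>k<m. P h (z k) (z (Suc k)))"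
        if "\<forall>k\<le>m. z k \<in> S" for m z
        using markov[of "\<lambda>k. real k * h" m z] that elim
        by (simp add: follows_def algebra_simps)
      have xS: "\<forall>k\<le>n. x k \<in> S" using x by auto
      then have "\<forall>k\<le>Suc n. (x(Suc n := j)) k \<in> S" using j by auto
      from m[OF this] m[OF xS] show ?thesis by (simp add: p_def fun_upd_def mult.assoc)
    qed
    have step: "\<bar>f (Suc n) - f n + h * g n\<bar> \<le> \<delta> * h * g n" for n
    proof -
      have "f (Suc n) = (\<Sum>x\<in>PiE {..n} (\<lambda>_. ?A). \<Sum>j\<in>?A. p n x * (P h (x n) j * u j))"
        unfolding f_def sum_PiE_atMost_Suc by (intro sum.cong refl) (simp add: p_Suc mult.assoc)
      also have "\<dots> = (\<Sum>x\<in>PiE {..n} (\<lambda>_. ?A). p n x * (\<Sum>j\<in>S. P h (x n) j * u j))"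
        unfolding sum_distrib_left[symmetric] using finite_states uy
        by (intro sum.cong refl arg_cong2[where f="(*)"] sum.mono_neutral_left) auto
      finally have "f (Suc n) - f n + h * g n
        = (\<Sum>x\<in>PiE {..n} (\<lambda>_. ?A). p n x * ((\<Sum>j\<in>S. P h (x n) j * u j) - u (x n) + h))"
        unfolding f_def g_sum by (simp add: sum_distrib_left sum_subtractf sum.distrib algebra_simps)
      also have "\<bar>\<dots>\<bar> \<le> (\<Sum>x\<in>PiE {..n} (\<lambda>_. ?A). p n x * (\<delta> * h))"
        using p_nn elim(1)
        by (intro order_trans[OF sum_abs] sum_mono) (auto simp: abs_mult intro!: mult_left_mono)
      also have "\<dots> = \<delta> * h * g n" unfolding g_sum by (simp add: sum_distrib_left mult.commute)
      finally show ?thesis .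
    qed
    have ag: "a * g n \<le> f n" for n
    proof -
      have "p n x * a \<le> p n x * u (x n)" if "x \<in> PiE {..n} (\<lambda>_. ?A)" for x
        using u that p_nn by (intro mult_left_mono) (auto simp: PiE_iff)
      then show ?thesis unfolding f_def g_sum sum_distrib_left by (intro sum_mono) (simp add: mult.commute)
    qed
    have bg: "f n \<le> b * g n" for n
    proof -
      have "p n x * u (x n) \<le> p n x * b" if "x \<in> PiE {..n} (\<lambda>_. ?A)" for x
        using u that p_nn by (intro mult_left_mono) (auto simp: PiE_iff)
      then show ?thesis unfolding f_def g_sum sum_distrib_left by (intro sum_mono) (simp add: mult.commute)
    qed
    have "g 0 = 1"
      unfolding g_def using start by (subst prob_eq_1) (auto simp: avoids_def)
    then have f0: "a \<le> f 0" "f 0 \<le> b" using ag[of 0] bg[of 0] by auto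
    have "h * (1 + \<delta>) \<le> h * 2" "h * (1 - \<delta>) \<le> h * 1" using elim d by (auto intro!: mult_left_mono)
    then have small: "h * (1 + \<delta>) \<le> a" "h * (1 - \<delta>) \<le> b" using elim ab a by linarith+
    note sandwich = discrete_gronwall_sandwich[where f = f and g = g, OF a b less_imp_le[OF elim(3)] less_imp_le[OF d(1)] d(2) small ag bg step]
    show ?case
    proof (intro allI conjI)
      fix n
      have "a * (1 - h * (1 + \<delta>) / a) ^ n \<le> f 0 * (1 - h * (1 + \<delta>) / a) ^ n"
        using f0 small a by (intro mult_right_mono zero_le_power) (auto simp: field_simps)
      also have "\<dots> \<le> b * g n" using sandwich(1)[of n] bg[of n] by simp
      finally show "a / b * (1 - h * (1 + \<delta>) / a) ^ n \<le> prob (avoids y h n)"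
        using b by (simp add: g_def field_simps)
      have "a * g n \<le> f 0 * (1 - h * (1 - \<delta>) / b) ^ n" using sandwich(2)[of n] ag[of n] by simp
      also have "\<dots> \<le> b * (1 - h * (1 - \<delta>) / b) ^ n"
        using f0 small b by (intro mult_right_mono zero_le_power) (auto simp: field_simps)
      finally show "prob (avoids y h n) \<le> b / a * (1 - h * (1 - \<delta>) / b) ^ n"
        using a by (simp add: g_def field_simps)
    qed
  qed
qed

section \<open>The first passage time in continuous time\<close>

lemma constant_after:
  assumes "\<omega> \<in> space M" "0 \<le> t"
  obtains b where "t < b" "\<And>s. t \<le> s \<Longrightarrow> s < b \<Longrightarrow> X s \<omega> = X t \<omega>"
proof -
  obtain b where "t < b" "\<forall>s>t. s < b \<longrightarrow> X s \<omega> = X t \<omega>"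
    using right_continuous_paths[OF assms] unfolding eventually_at_right_field by blast
  then show thesis using that[of b] by (metis order_le_less)
qed

text \<open>Strictness on the left matches the closed interval on the right by right continuity: a process
that is off \<open>y\<close> at time \<open>t\<close> stays off \<open>y\<close> for a further positive time. The initial condition
is needed because the infimum ranges over positive times only.\<close>
lemma less_first_passage_time_iff:
  assumes w: "\<omega> \<in> space M" and start: "X 0 \<omega> \<noteq> y" and t: "0 \<le> t"
  shows "ennreal t < first_passage_time X y \<omega> \<longleftrightarrow> (\<forall>s\<in>{0..t}. X s \<omega> \<noteq> y)"
proof
  assume *: "ennreal t < first_passage_time X y \<omega>"
  show "\<forall>s\<in>{0..t}. X s \<omega> \<noteq> y"
  proof (intro ballI notI)
    fix s assume s: "s \<in> {0..t}" and Xs: "X s \<omega> = y"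
    then have "s \<noteq> 0" using start by auto
    then have "first_passage_time X y \<omega> \<le> ennreal s"
      using s Xs unfolding first_passage_time_def by (intro INF_lower) auto
    also have "\<dots> \<le> ennreal t" using s by (intro ennreal_leI) auto
    finally show False using * by simp
  qed
next
  assume *: "\<forall>s\<in>{0..t}. X s \<omega> \<noteq> y"
  obtain b where b: "t < b" "\<And>s. t \<le> s \<Longrightarrow> s < b \<Longrightarrow> X s \<omega> = X t \<omega>"
    using constant_after[OF w t] by blast
  have "ennreal t < ennreal b" using b t by (simp add: ennreal_less_iff)
  also have "ennreal b \<le> first_passage_time X y \<omega>"
    unfolding first_passage_time_def
  proof (intro INF_greatest ennreal_leI)
    fix s assume "s \<in> {t. 0 < t \<and> X t \<omega> = y}"
    then show "b \<le> s" using * b(2)[of s] t by (cases "s \<le> t"; cases "s < b") auto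
  qed
  finally show "ennreal t < first_passage_time X y \<omega>" .
qed

text \<open>By right continuity a visit to \<open>y\<close> at time \<open>t\<close> continues to rational times arbitrarily close to
\<open>t\<close>, so the infimum may be taken over the countable set of positive rationals.\<close>
lemma first_passage_time_measurable [measurable]:
  "first_passage_time X y \<in> borel_measurable M"
proof -
  let ?Q = "{r\<in>\<rat>. 0 < r} :: real set"
  have "first_passage_time X y \<omega> = (INF r\<in>?Q. if X r \<omega> = y then ennreal r else \<infinity>)"
    if w: "\<omega> \<in> space M" for \<omega>
  proof (rule antisym)
    show "first_passage_time X y \<omega> \<le> (INF r\<in>?Q. if X r \<omega> = y then ennreal r else \<infinity>)"
      unfolding first_passage_time_def by (intro INF_greatest) (auto intro!: INF_lower)
    show "(INF r\<in>?Q. if X r \<omega> = y then ennreal r else \<infinity>) \<le> first_passage_time X y \<omega>"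
      unfolding first_passage_time_def
    proof (intro INF_greatest)
      fix t assume t: "t \<in> {t. 0 < t \<and> X t \<omega> = y}"
      then obtain b where b: "t < b" "\<And>s. t \<le> s \<Longrightarrow> s < b \<Longrightarrow> X s \<omega> = X t \<omega>"
        using constant_after[OF w, of t] by auto
      show "(INF r\<in>?Q. if X r \<omega> = y then ennreal r else \<infinity>) \<le> ennreal t"
      proof (rule ennreal_le_epsilon)
        fix e :: real assume "0 < e"
        obtain r where r: "r \<in> \<rat>" "t < r" "r < min b (t + e)"
          using Rats_dense_in_real[of t "min b (t + e)"] b \<open>0 < e\<close> by auto
        have "(INF r\<in>?Q. if X r \<omega> = y then ennreal r else \<infinity>) \<le> (if X r \<omega> = y then ennreal r else \<infinity>)"
          using r t by (intro INF_lower) auto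
        also have "\<dots> = ennreal r" using b(2)[of r] r t by simp
        also have "\<dots> \<le> ennreal t + ennreal e"
          using r t \<open>0 < e\<close> by (simp flip: ennreal_plus add: ennreal_leI)
        finally show "(INF r\<in>?Q. if X r \<omega> = y then ennreal r else \<infinity>) \<le> ennreal t + ennreal e" .
      qed
    qed
  qed
  moreover have "(\<lambda>\<omega>. INF r\<in>?Q. if X r \<omega> = y then ennreal r else \<infinity>) \<in> borel_measurable M"
  proof (intro borel_measurable_INF)
    show "countable ?Q" using countable_rat by (rule countable_subset[rotated]) auto
    fix r assume "r \<in> ?Q"
    then have [measurable]: "Measurable.pred M (\<lambda>\<omega>. X r \<omega> = y)" by (intro pred_X) auto
    show "(\<lambda>\<omega>. if X r \<omega> = y then ennreal r else \<infinity>) \<in> borel_measurable M" by measurable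
  qed
  ultimately show ?thesis by (subst measurable_cong) auto
qed

text \<open>The dyadic grids are nested, so continuity from above applies. A visit to \<open>y\<close> before time \<open>t\<close>
lasts for a positive time and is seen by every fine enough grid; a visit at \<open>t\<close> itself is seen by
all grids, since \<open>t\<close> is a grid point.\<close>
lemma prob_dyadic_avoids_tendsto:
  assumes start: "AE \<omega> in M. X 0 \<omega> \<noteq> y" and t: "0 < t"
  shows "(\<lambda>n. prob (avoids y (t / 2 ^ n) (2 ^ n)))
    \<longlonglongrightarrow> prob {\<omega>\<in>space M. ennreal t < first_passage_time X y \<omega>}"
proof -
  let ?D = "\<lambda>n. avoids y (t / 2 ^ n) (2 ^ n)"
  have sets: "range ?D \<subseteq> events" using t by (auto intro!: avoids_sets)
  have "decseq ?D"
  proof (rule decseq_SucI, rule subsetI)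
    fix n \<omega> assume w: "\<omega> \<in> ?D (Suc n)"
    have "X (real k * (t / 2 ^ n)) \<omega> \<noteq> y" if "k \<le> 2 ^ n" for k
    proof -
      have "X (real (2 * k) * (t / 2 ^ Suc n)) \<omega> \<noteq> y"
        using w that unfolding avoids_def by (metis (mono_tags, lifting) mem_Collect_eq mult_le_mono2 power_Suc)
      then show ?thesis by simp
    qed
    then show "\<omega> \<in> ?D n" using w by (auto simp: avoids_def)
  qed
  then have "(\<lambda>n. prob (?D n)) \<longlonglongrightarrow> prob (\<Inter>n. ?D n)"
    using sets by (intro finite_Lim_measure_decseq)
  also have "prob (\<Inter>n. ?D n) = prob {\<omega>\<in>space M. ennreal t < first_passage_time X y \<omega>}"
  proof (rule finite_measure_eq_AE)
    show "AE \<omega> in M. \<omega> \<in> (\<Inter>n. ?D n) \<longleftrightarrow> \<omega> \<in> {\<omega>\<in>space M. ennreal t < first_passage_time X y \<omega>}"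
      using start AE_space
    proof eventually_elim
      case (elim \<omega>)
      have "(\<forall>n. \<omega> \<in> ?D n) \<longleftrightarrow> (\<forall>s\<in>{0..t}. X s \<omega> \<noteq> y)"
      proof
        assume "\<forall>s\<in>{0..t}. X s \<omega> \<noteq> y"
        moreover have "real k * (t / 2 ^ n) \<in> {0..t}" if "k \<le> 2 ^ n" for k n
        proof -
          have "real k \<le> 2 ^ n" using that by (simp flip: of_nat_le_iff)
          then have "real k * t \<le> 2 ^ n * t" using t by (intro mult_right_mono) auto
          then show ?thesis using t by (auto simp: field_simps)
        qed
        ultimately show "\<forall>n. \<omega> \<in> ?D n" using elim by (auto simp: avoids_def)
      next
        assume D: "\<forall>n. \<omega> \<in> ?D n"
        have grid: "X (real k * (t / 2 ^ n)) \<omega> \<noteq> y" if "k \<le> 2 ^ n" for k n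
          using D that by (auto simp: avoids_def)
        show "\<forall>s\<in>{0..t}. X s \<omega> \<noteq> y"
        proof (intro ballI notI)
          fix s assume s: "s \<in> {0..t}" and Xs: "X s \<omega> = y"
          show False
          proof (cases "s = t")
            case True
            then show False using grid[of 1 0] Xs by simp
          next
            case False
            obtain b where b: "s < b" "\<And>r. s \<le> r \<Longrightarrow> r < b \<Longrightarrow> X r \<omega> = X s \<omega>"
              using constant_after[OF elim(2)] s by auto
            have "0 < (min b t - s) / t" using b False s t by auto
            then obtain n where n: "(1 / 2) ^ n < (min b t - s) / t"
              using real_arch_pow_inv[of "(min b t - s) / t" "1 / 2"] by auto
            \<comment> \<open>The first grid point strictly after \<open>s\<close>; it precedes both \<open>t\<close> and the end of the visit.\<close>
            define k where "k = nat \<lfloor>s * 2 ^ n / t\<rfloor> + 1"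
            have fl: "real k = of_int \<lfloor>s * 2 ^ n / t\<rfloor> + 1" using s t by (simp add: k_def)
            have k1: "s * 2 ^ n / t < real k" and k2: "real k \<le> s * 2 ^ n / t + 1"
              unfolding fl by linarith+
            have 1: "s < real k * (t / 2 ^ n)" using k1 t by (simp add: field_simps)
            have "real k * (t / 2 ^ n) \<le> (s * 2 ^ n / t + 1) * (t / 2 ^ n)"
              using k2 t by (intro mult_right_mono) auto
            also have "\<dots> = s + t * (1 / 2) ^ n" using t by (simp add: field_simps power_divide)
            also have "\<dots> < min b t" using n t by (simp add: field_simps)
            finally have 2: "real k * (t / 2 ^ n) < min b t" .
            then have "real k * t < 2 ^ n * t" by (simp add: field_simps)
            then have "real k < 2 ^ n" using t by (simp only: mult_less_cancel_right_pos)
            then have "k \<le> 2 ^ n" by (simp flip: of_nat_le_iff)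
            moreover have "X (real k * (t / 2 ^ n)) \<omega> = y"
              using b(2)[of "real k * (t / 2 ^ n)"] 1 2 Xs by simp
            ultimately show False using grid by blast
          qed
        qed
      qed
      then show ?case using less_first_passage_time_iff[OF elim(2,1)] t elim by auto
    qed
  qed (use sets in auto)
  finally show ?thesis .
qed

text \<open>The function \<open>u\<close> plays the role of the mean hitting time of \<open>y\<close>. If it is nearly constant off
\<open>y\<close>, then \<open>a\<close> and \<open>b\<close> nearly agree and the hitting time is nearly exponential, whatever the
initial law on the complement of \<open>y\<close>. The bounds come from \<open>grid_survival_bounds\<close> with
\<open>h = t / 2 ^ n\<close>: first the mesh tends to 0, then \<open>\<delta>\<close>.\<close>
lemma survival_bounds:
  assumes a: "0 < a" and drift: "\<And>i. i \<in> S - {y} \<Longrightarrow> (\<Sum>j\<in>S - {i}. q i j * (u j - u i)) = - 1"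
    and uy: "u y = 0" and u: "\<And>i. i \<in> S - {y} \<Longrightarrow> a \<le> u i \<and> u i \<le> b" and ab: "a \<le> b"
    and start: "AE \<omega> in M. X 0 \<omega> \<noteq> y" and t: "0 \<le> t"
  shows "a / b * exp (- t / a) \<le> prob {\<omega>\<in>space M. ennreal t < first_passage_time X y \<omega>}" (is "_ \<le> ?G")
    and "prob {\<omega>\<in>space M. ennreal t < first_passage_time X y \<omega>} \<le> b / a * exp (- t / b)"
proof -
  have b: "0 < b" using a ab by simp
  have "a / b * exp (- t / a) \<le> ?G \<and> ?G \<le> b / a * exp (- t / b)"
  proof (cases "t = 0")
    case True
    have "AE \<omega> in M. 0 < first_passage_time X y \<omega>"
      using start AE_space
    proof eventually_elim
      case (elim \<omega>)
      then show ?case using less_first_passage_time_iff[OF elim(2,1), of 0] by simp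
    qed
    then have "?G = 1" using True by (subst prob_eq_1) auto
    then show ?thesis using True a ab by (simp add: field_simps)
  next
    case False
    then have t: "0 < t" using t by simp
    have pow: "(\<lambda>n. (1 - t / 2 ^ n * c) ^ (2 ^ n)) \<longlonglongrightarrow> exp (- t * c)" for c :: real
    proof -
      have "filterlim (\<lambda>n::nat. 2 ^ n :: nat) sequentially sequentially"
        by (rule filterlim_subseq) (simp add: strict_mono_def)
      from filterlim_compose[OF tendsto_exp_limit_sequentially[of "- t * c"] this]
      show ?thesis by (simp add: field_simps)
    qed
    have small: "filterlim (\<lambda>n::nat. t / 2 ^ n) (at_right 0) sequentially"
    proof (rule tendsto_imp_filterlim_at_right)
      have "(\<lambda>n. t * (1 / 2) ^ n) \<longlonglongrightarrow> t * 0" by (intro tendsto_intros) auto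
      then show "(\<lambda>n. t / 2 ^ n) \<longlonglongrightarrow> 0" by (simp add: power_divide)
    qed (use t in auto)
    have bounds: "a / b * exp (- t * ((1 + \<delta>) / a)) \<le> ?G \<and> ?G \<le> b / a * exp (- t * ((1 - \<delta>) / b))"
      if d: "0 < \<delta>" "\<delta> \<le> 1" for \<delta>
    proof -
      have ev: "\<forall>\<^sub>F n in sequentially. \<forall>m.
         a / b * (1 - t / 2 ^ n * (1 + \<delta>) / a) ^ m \<le> prob (avoids y (t / 2 ^ n) m) \<and>
         prob (avoids y (t / 2 ^ n) m) \<le> b / a * (1 - t / 2 ^ n * (1 - \<delta>) / b) ^ m"
        using eventually_compose_filterlim[OF grid_survival_bounds[OF a drift uy u ab start d] small] by simp
      show ?thesis
      proof
        show "a / b * exp (- t * ((1 + \<delta>) / a)) \<le> ?G"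
        proof (rule tendsto_le[OF _ prob_dyadic_avoids_tendsto[OF start t] tendsto_mult[OF tendsto_const pow]])
          show "\<forall>\<^sub>F n in sequentially. a / b * (1 - t / 2 ^ n * ((1 + \<delta>) / a)) ^ 2 ^ n \<le> prob (avoids y (t / 2 ^ n) (2 ^ n))"
            using ev by eventually_elim (simp only: times_divide_eq_right)
        qed simp
        show "?G \<le> b / a * exp (- t * ((1 - \<delta>) / b))"
        proof (rule tendsto_le[OF _ tendsto_mult[OF tendsto_const pow] prob_dyadic_avoids_tendsto[OF start t]])
          show "\<forall>\<^sub>F n in sequentially. prob (avoids y (t / 2 ^ n) (2 ^ n)) \<le> b / a * (1 - t / 2 ^ n * ((1 - \<delta>) / b)) ^ 2 ^ n"
            using ev by eventually_elim (simp only: times_divide_eq_right)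
        qed simp
      qed
    qed
    have "\<forall>\<^sub>F \<delta>::real in at_right 0. \<delta> \<in> {0<..<1}" by (rule eventually_at_right_real) simp
    then have ev: "\<forall>\<^sub>F \<delta> in at_right 0. a / b * exp (- t * ((1 + \<delta>) / a)) \<le> ?G"
      "\<forall>\<^sub>F \<delta> in at_right 0. ?G \<le> b / a * exp (- t * ((1 - \<delta>) / b))"
      by (auto elim!: eventually_mono dest!: bounds[OF _ less_imp_le])
    have "((\<lambda>\<delta>. a / b * exp (- t * ((1 + \<delta>) / a))) \<longlongrightarrow> a / b * exp (- t * ((1 + 0) / a))) (at_right 0)"
      using a b by (intro tendsto_intros) auto
    from tendsto_upperbound[OF this ev(1)]
    have lower: "a / b * exp (- t / a) \<le> ?G" by simp
    have "((\<lambda>\<delta>. b / a * exp (- t * ((1 - \<delta>) / b))) \<longlongrightarrow> b / a * exp (- t * ((1 - 0) / b))) (at_right 0)"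
      using a b by (intro tendsto_intros) auto
    from tendsto_lowerbound[OF this ev(2)]
    have "?G \<le> b / a * exp (- t / b)" by simp
    with lower show ?thesis by blast
  qed
  then show "a / b * exp (- t / a) \<le> ?G" "?G \<le> b / a * exp (- t / b)" by auto
qed

end

section \<open>Tail integrals and distribution functions\<close>

text \<open>Layer-cake formula: \<open>T \<omega>\<close> is the length of the interval of those \<open>t \<ge> 0\<close> with \<open>t < T \<omega>\<close>, and
the two integrations commute.\<close>
lemma nn_integral_eq_integral_tail:
  assumes "prob_space M" and [measurable]: "T \<in> borel_measurable M"
  shows "(\<integral>\<^sup>+\<omega>. T \<omega> \<partial>M) = (\<integral>\<^sup>+t. ennreal (measure M {\<omega>\<in>space M. ennreal t < T \<omega>}) * indicator {0..} t \<partial>lborel)"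
proof -
  interpret M: prob_space M by fact
  interpret pair_sigma_finite M lborel ..
  have meas: "(\<lambda>(\<omega>, t). indicator {p. ennreal (snd p) < T (fst p)} (\<omega>, t) * indicator {0..} t :: ennreal)
      \<in> borel_measurable (M \<Otimes>\<^sub>M lborel)"
    by measurable
  have layers: "T \<omega> = (\<integral>\<^sup>+t. indicator {p. ennreal (snd p) < T (fst p)} (\<omega>, t) * indicator {0..} t \<partial>lborel)" for \<omega>
  proof (cases "T \<omega>")
    case (real r)
    then have "(\<integral>\<^sup>+t. indicator {p. ennreal (snd p) < T (fst p)} (\<omega>, t) * indicator {0..} t \<partial>lborel)
      = (\<integral>\<^sup>+t. indicator {0..<r} t \<partial>lborel)"
      by (intro nn_integral_cong) (auto simp: ennreal_less_iff split: split_indicator)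
    then show ?thesis using real by simp
  next
    case top
    then have "(\<integral>\<^sup>+t. indicator {p. ennreal (snd p) < T (fst p)} (\<omega>, t) * indicator {0..} t \<partial>lborel)
      = (\<integral>\<^sup>+t. indicator {0::real..} t \<partial>lborel)"
      by (intro nn_integral_cong) (auto split: split_indicator)
    also have "\<dots> = \<infinity>"
    proof -
      have "\<not> emeasure lborel {0::real..} < top"
      proof
        assume "emeasure lborel {0::real..} < top"
        then obtain n where n: "emeasure lborel {0::real..} < of_nat n"
          using ennreal_Ex_less_of_nat by blast
        have "of_nat n = emeasure lborel {0..real n}"
          unfolding ennreal_of_nat_eq_real_of_nat by simp
        also have "\<dots> \<le> emeasure lborel {0::real..}" by (intro emeasure_mono) auto
        finally show False using n by simp
      qed
      then have "emeasure lborel {0::real..} = top" unfolding less_top[symmetric] by blast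
      then show ?thesis by simp
    qed
    finally show ?thesis using top by simp
  qed
  have "(\<integral>\<^sup>+\<omega>. T \<omega> \<partial>M)
    = (\<integral>\<^sup>+\<omega>. \<integral>\<^sup>+t. indicator {p. ennreal (snd p) < T (fst p)} (\<omega>, t) * indicator {0..} t \<partial>lborel \<partial>M)"
    by (intro nn_integral_cong) (rule layers)
  also have "\<dots> = (\<integral>\<^sup>+t. \<integral>\<^sup>+\<omega>. indicator {p. ennreal (snd p) < T (fst p)} (\<omega>, t) * indicator {0..} t \<partial>M \<partial>lborel)"
    using Fubini'[OF meas] by simp
  also have "\<dots> = (\<integral>\<^sup>+t. ennreal (measure M {\<omega>\<in>space M. ennreal t < T \<omega>}) * indicator {0..} t \<partial>lborel)"
  proof (intro nn_integral_cong)
    fix t :: real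
    have "(\<integral>\<^sup>+\<omega>. indicator {p. ennreal (snd p) < T (fst p)} (\<omega>, t) * indicator {0..} t \<partial>M)
      = (\<integral>\<^sup>+\<omega>. indicator {0..} t * indicator {\<omega>\<in>space M. ennreal t < T \<omega>} \<omega> \<partial>M)"
      by (intro nn_integral_cong) (auto split: split_indicator)
    also have "\<dots> = indicator {0..} t * emeasure M {\<omega>\<in>space M. ennreal t < T \<omega>}"
      by (intro nn_integral_cmult_indicator) measurable
    finally show "(\<integral>\<^sup>+\<omega>. indicator {p. ennreal (snd p) < T (fst p)} (\<omega>, t) * indicator {0..} t \<partial>M)
      = ennreal (measure M {\<omega>\<in>space M. ennreal t < T \<omega>}) * indicator {0..} t"
      by (simp add: M.emeasure_eq_measure mult.commute)
  qed
  finally show ?thesis .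
qed

lemma nn_integral_exponential_tail:
  assumes "0 \<le> k" "0 < b"
  shows "(\<integral>\<^sup>+t. ennreal (k * exp (- t / b)) * indicator {0..} t \<partial>lborel) = ennreal (k * b)"
proof -
  have "(\<integral>\<^sup>+t. ennreal (k * exp (- t / b)) * indicator {0..} t \<partial>lborel)
    = (\<integral>\<^sup>+t. ennreal (k * b) * ennreal (exponential_density (1 / b) t) \<partial>lborel)"
    using assms by (intro nn_integral_cong)
      (auto simp: exponential_density_def ennreal_mult[symmetric] split: split_indicator)
  also have "\<dots> = ennreal (k * b) * (\<integral>\<^sup>+t. ennreal (exponential_density (1 / b) t) \<partial>lborel)"
    by (intro nn_integral_cmult) measurable
  also have "(\<integral>\<^sup>+t. ennreal (exponential_density (1 / b) t) \<partial>lborel) = 1"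
    using prob_space.emeasure_space_1[OF prob_space_exponential_density[of "1 / b"]] assms
    by (simp add: emeasure_density)
  finally show ?thesis by simp
qed

lemma cdf_exponential_law:
  "0 < l \<Longrightarrow> cdf (exponential_law l) x = (if 0 \<le> x then 1 - exp (- l * x) else 0)"
  unfolding cdf_def measure_def exponential_law_def
  by (simp add: emeasure_erlang_density erlang_CDF_0)

text \<open>A finite mean makes the variable almost surely finite, so the convention that \<open>enn2real\<close> sends
infinity to 0 only affects a null set.\<close>
lemma cdf_normalised_law:
  assumes "prob_space M" and [measurable]: "T \<in> borel_measurable M"
    and mean: "(\<integral>\<^sup>+\<omega>. T \<omega> \<partial>M) = ennreal m" and m: "0 < m"
  shows "cdf (normalised_law M T) x = (if 0 \<le> x then 1 - measure M {\<omega>\<in>space M. ennreal (x * m) < T \<omega>} else 0)"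
proof -
  interpret prob_space M by fact
  have fin: "AE \<omega> in M. T \<omega> \<noteq> \<infinity>"
    using mean by (intro nn_integral_PInf_AE) auto
  have "cdf (normalised_law M T) x = prob {\<omega>\<in>space M. enn2real (T \<omega> / ennreal m) \<le> x}"
    unfolding normalised_law_def cdf_def mean
    by (subst measure_distr) (auto intro!: arg_cong[where f=prob])
  also have "\<dots> = (if 0 \<le> x then 1 - prob {\<omega>\<in>space M. ennreal (x * m) < T \<omega>} else 0)"
  proof (cases "0 \<le> x")
    case False
    have "\<not> enn2real (T \<omega> / ennreal m) \<le> x" for \<omega>
      using False enn2real_nonneg[of "T \<omega> / ennreal m"] by linarith
    then show ?thesis using False by simp
  next
    case True
    have "prob {\<omega>\<in>space M. enn2real (T \<omega> / ennreal m) \<le> x} = prob (space M - {\<omega>\<in>space M. ennreal (x * m) < T \<omega>})"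
    proof (rule finite_measure_eq_AE)
      show "AE \<omega> in M. \<omega> \<in> {\<omega>\<in>space M. enn2real (T \<omega> / ennreal m) \<le> x} \<longleftrightarrow>
        \<omega> \<in> space M - {\<omega>\<in>space M. ennreal (x * m) < T \<omega>}"
        using fin
      proof eventually_elim
        case (elim \<omega>)
        then obtain r where r: "0 \<le> r" "T \<omega> = ennreal r" by (cases "T \<omega>") auto
        have "enn2real (T \<omega> / ennreal m) = r / m"
          using r m by (simp add: divide_ennreal)
        moreover have "r / m \<le> x \<longleftrightarrow> r \<le> x * m" using m by (rule pos_divide_le_eq)
        moreover have "ennreal (x * m) < T \<omega> \<longleftrightarrow> x * m < r"
          using r m True by (simp add: ennreal_less_iff)
        ultimately show ?case by auto
      qed
    qed measurable
    also have "\<dots> = 1 - prob {\<omega>\<in>space M. ennreal (x * m) < T \<omega>}"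
      by (subst prob_compl) auto
    finally show ?thesis using True by simp
  qed
  finally show ?thesis .
qed

section \<open>Quantitative exponential approximation\<close>

context finite_markov_jump_process
begin

text \<open>Integrating the survival bounds over time locates the mean between \<open>a / c\<close> and \<open>c * (c * a)\<close>.
It therefore differs from the time scales \<open>a\<close> and \<open>c * a\<close> of these bounds by a factor of at most
\<open>c\<^sup>2\<close> in the relevant direction, whence the square in the exponents.\<close>
lemma cdf_normalised_first_passage_bounds:
  assumes a: "0 < a" and drift: "\<And>i. i \<in> S - {y} \<Longrightarrow> (\<Sum>j\<in>S - {i}. q i j * (u j - u i)) = - 1"
    and uy: "u y = 0" and u: "\<And>i. i \<in> S - {y} \<Longrightarrow> a \<le> u i \<and> u i \<le> c * a" and c: "1 \<le> c"
    and start: "AE \<omega> in M. X 0 \<omega> \<noteq> y"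
  shows "x < 0 \<Longrightarrow> cdf (normalised_law M (first_passage_time X y)) x = 0"
    and "0 \<le> x \<Longrightarrow> 1 - c * exp (- x / c\<^sup>2) \<le> cdf (normalised_law M (first_passage_time X y)) x"
    and "0 \<le> x \<Longrightarrow> cdf (normalised_law M (first_passage_time X y)) x \<le> 1 - exp (- x * c\<^sup>2) / c"
proof -
  let ?T = "first_passage_time X y" and ?b = "c * a"
  let ?G = "\<lambda>t. prob {\<omega>\<in>space M. ennreal t < ?T \<omega>}"
  have ab: "a \<le> ?b" and b: "0 < ?b" using a c by auto
  have G: "exp (- t / a) / c \<le> ?G t" "?G t \<le> c * exp (- t / ?b)" if "0 \<le> t" for t
    using survival_bounds[OF a drift uy u ab start that] a c by simp_all
  have tail: "(\<integral>\<^sup>+\<omega>. ?T \<omega> \<partial>M) = (\<integral>\<^sup>+t. ennreal (?G t) * indicator {0..} t \<partial>lborel)"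
    by (rule nn_integral_eq_integral_tail) (auto intro: prob_space_axioms)
  have "(\<integral>\<^sup>+\<omega>. ?T \<omega> \<partial>M) \<le> (\<integral>\<^sup>+t. ennreal (c * exp (- t / ?b)) * indicator {0..} t \<partial>lborel)"
    unfolding tail using G(2) by (intro nn_integral_mono) (auto intro!: ennreal_leI split: split_indicator)
  also have "\<dots> = ennreal (c * ?b)" using b c by (intro nn_integral_exponential_tail) auto
  finally have up: "(\<integral>\<^sup>+\<omega>. ?T \<omega> \<partial>M) \<le> ennreal (c * ?b)" .
  have "ennreal (1 / c * a) = (\<integral>\<^sup>+t. ennreal (1 / c * exp (- t / a)) * indicator {0..} t \<partial>lborel)"
    using a c by (intro nn_integral_exponential_tail[symmetric]) auto
  also have "\<dots> \<le> (\<integral>\<^sup>+\<omega>. ?T \<omega> \<partial>M)"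
    unfolding tail using G(1) by (intro nn_integral_mono) (auto intro!: ennreal_leI split: split_indicator)
  finally have lo: "ennreal (a / c) \<le> (\<integral>\<^sup>+\<omega>. ?T \<omega> \<partial>M)" by simp
  obtain m where m: "0 \<le> m" "(\<integral>\<^sup>+\<omega>. ?T \<omega> \<partial>M) = ennreal m"
    using up by (cases "\<integral>\<^sup>+\<omega>. ?T \<omega> \<partial>M") (auto simp: top_unique)
  have mb: "a / c \<le> m" "m \<le> c * ?b"
    using lo up b c m by (auto simp: ennreal_le_iff)
  have "0 < a / c" using a c by simp
  then have "0 < m" using mb by linarith
  note cdf = cdf_normalised_law[OF prob_space_axioms first_passage_time_measurable m(2) this]
  show "cdf (normalised_law M ?T) x = 0" if "x < 0" using that by (simp add: cdf)
  assume x: "0 \<le> x"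
  have "x / c\<^sup>2 \<le> x * m / ?b"
  proof -
    have "x * (a / c) / ?b \<le> x * m / ?b" using x mb b by (intro divide_right_mono mult_left_mono) auto
    moreover have "x * (a / c) / ?b = x / c\<^sup>2" using a c by (simp add: power2_eq_square)
    ultimately show ?thesis by simp
  qed
  then have "c * exp (- (x * m) / ?b) \<le> c * exp (- x / c\<^sup>2)" using c by (intro mult_left_mono) auto
  then show "1 - c * exp (- x / c\<^sup>2) \<le> cdf (normalised_law M ?T) x"
    using G(2)[of "x * m"] x m by (simp add: cdf)
  have "x * m / a \<le> x * c\<^sup>2"
  proof -
    have "x * m / a \<le> x * (c * ?b) / a" using x mb a by (intro divide_right_mono mult_left_mono) auto
    then show ?thesis using a by (simp add: power2_eq_square)
  qed
  then have "exp (- x * c\<^sup>2) / c \<le> exp (- (x * m) / a) / c" using c by (intro divide_right_mono) auto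
  then show "cdf (normalised_law M ?T) x \<le> 1 - exp (- x * c\<^sup>2) / c"
    using G(1)[of "x * m"] x m by (simp add: cdf)
qed

end

section \<open>The birth-and-death chain\<close>

text \<open>The mean time of descent from level \<open>L - r\<close> to \<open>L - r - 1\<close>. From the top level \<open>L\<close> it is
\<open>1 / L\<close>. From level \<open>l = L - Suc r\<close> a first-step analysis gives
\<open>l * d (Suc r) = 1 + (L - l) * \<nu> * d r\<close>: every upward jump has to be undone by a descent from
level \<open>l + 1\<close>.\<close>
fun descent_mean :: "nat \<Rightarrow> real \<Rightarrow> nat \<Rightarrow> real" where
  "descent_mean L \<nu> 0 = 1 / real L"
| "descent_mean L \<nu> (Suc r) = (1 + real (Suc r) * \<nu> * descent_mean L \<nu> r) / real (L - Suc r)"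

text \<open>Jumps have size one, so hitting 0 from \<open>l\<close> means descending through all levels below \<open>l\<close>
in turn.\<close>
definition hitting_mean :: "nat \<Rightarrow> real \<Rightarrow> nat \<Rightarrow> real" where
  "hitting_mean L \<nu> l = (\<Sum>k\<in>{1..l}. descent_mean L \<nu> (L - k))"

lemma descent_mean_nonneg: "0 \<le> \<nu> \<Longrightarrow> 0 \<le> descent_mean L \<nu> r"
  by (induction r) auto

lemma hitting_mean_0: "hitting_mean L \<nu> 0 = 0"
  by (simp add: hitting_mean_def)

lemma hitting_mean_1: "hitting_mean L \<nu> 1 = descent_mean L \<nu> (L - 1)"
  by (simp add: hitting_mean_def)

lemma hitting_mean_diff: "1 \<le> l \<Longrightarrow> hitting_mean L \<nu> l - hitting_mean L \<nu> (l - 1) = descent_mean L \<nu> (L - l)"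
  by (cases l) (simp_all add: hitting_mean_def)

lemma descent_mean_recurrence:
  assumes "1 \<le> l" "l \<le> L"
  shows "real l * descent_mean L \<nu> (L - l) = 1 + (if l < L then real (L - l) * \<nu> * descent_mean L \<nu> (L - Suc l) else 0)"
proof (cases "l = L")
  case True
  then show ?thesis using assms by simp
next
  case False
  then have e: "L - l = Suc (L - Suc l)" using assms by simp
  have "L - Suc (L - Suc l) = l" using False assms by simp
  then show ?thesis using False assms by (simp add: e)
qed

text \<open>The function solves the Poisson equation for the mean hitting time of 0. In terms of increments
the equation at level \<open>l\<close> is the recurrence of \<open>descent_mean\<close>.\<close>
lemma generator_hitting_mean:
  assumes l: "1 \<le> l" "l \<le> L"
  shows "(\<Sum>j\<in>{0..L} - {l}. bd_rate L \<nu> l j * (hitting_mean L \<nu> j - hitting_mean L \<nu> l)) = - 1"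
proof -
  let ?g = "\<lambda>j. bd_rate L \<nu> l j * (hitting_mean L \<nu> j - hitting_mean L \<nu> l)"
  let ?N = "insert (l - 1) (if l < L then {Suc l} else {})"
  have "(\<Sum>j\<in>{0..L} - {l}. ?g j) = (\<Sum>j\<in>?N. ?g j)"
    using l by (intro sum.mono_neutral_right) (auto simp: bd_rate_def split: if_splits)
  also have "\<dots> = ?g (l - 1) + (if l < L then ?g (Suc l) else 0)"
    using l by auto
  also have "?g (l - 1) = - real l * descent_mean L \<nu> (L - l)"
    using l hitting_mean_diff[of l L \<nu>] by (auto simp: bd_rate_def algebra_simps)
  also have "(if l < L then ?g (Suc l) else 0)
      = (if l < L then real (L - l) * \<nu> * descent_mean L \<nu> (L - Suc l) else 0)"
    using hitting_mean_diff[of "Suc l" L \<nu>] by (auto simp: bd_rate_def)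
  finally show ?thesis using descent_mean_recurrence[OF l, of \<nu>] by simp
qed

text \<open>Each level further down multiplies the descent time by at least \<open>\<nu> / L\<close>, which is at least 1 here;
so one such factor separates the last descent, from 1 to 0, from all the others.\<close>
lemma descent_mean_le:
  assumes \<nu>: "real L \<le> \<nu>" and L: "1 \<le> L" and r: "Suc r < L"
  shows "descent_mean L \<nu> r \<le> real L / \<nu> * descent_mean L \<nu> (L - 1)"
proof -
  have pos: "0 < \<nu>" using \<nu> L by simp
  have step: "descent_mean L \<nu> s \<le> real L / \<nu> * descent_mean L \<nu> (Suc s)" if s: "Suc s < L" for s
  proof -
    let ?d = "descent_mean L \<nu> s"
    have d: "0 \<le> ?d" using pos by (intro descent_mean_nonneg) simp
    have "\<nu> * ?d \<le> real (Suc s) * (\<nu> * ?d)"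
      using mult_right_mono[of 1 "real (Suc s)" "\<nu> * ?d"] d pos by simp
    then have *: "\<nu> * ?d \<le> 1 + real (Suc s) * \<nu> * ?d" by (simp add: mult.assoc)
    have "\<nu> * ?d \<le> (1 + real (Suc s) * \<nu> * ?d) * (real L / real (L - Suc s))"
    proof -
      have "1 \<le> real L / real (L - Suc s)" using s by simp
      then have "(1 + real (Suc s) * \<nu> * ?d) * 1 \<le> (1 + real (Suc s) * \<nu> * ?d) * (real L / real (L - Suc s))"
        using d pos by (intro mult_left_mono add_nonneg_nonneg mult_nonneg_nonneg) auto
      then show ?thesis using * by simp
    qed
    then have "?d * \<nu> \<le> real L * descent_mean L \<nu> (Suc s)" by (simp add: mult.commute)
    then have "?d \<le> real L * descent_mean L \<nu> (Suc s) / \<nu>" using pos by (simp only: pos_le_divide_eq)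
    then show ?thesis by (simp only: times_divide_eq_left)
  qed
  have grow: "descent_mean L \<nu> s \<le> descent_mean L \<nu> (Suc s)" if s: "Suc s < L" for s
  proof -
    have "real L / \<nu> * descent_mean L \<nu> (Suc s) \<le> 1 * descent_mean L \<nu> (Suc s)"
      using \<nu> pos descent_mean_nonneg[of \<nu> L "Suc s"] by (intro mult_right_mono) auto
    then show ?thesis using step[OF s] by linarith
  qed
  have "Suc r \<le> L - 1" using r by simp
  then have "descent_mean L \<nu> (Suc r) \<le> descent_mean L \<nu> (L - 1)"
  proof (induction rule: inc_induct)
    case (step n)
    have "descent_mean L \<nu> n \<le> descent_mean L \<nu> (Suc n)" using step.hyps by (intro grow) simp
    then show ?case using step.IH by (rule order_trans)
  qed simp
  then have "real L / \<nu> * descent_mean L \<nu> (Suc r) \<le> real L / \<nu> * descent_mean L \<nu> (L - 1)"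
    using pos by (intro mult_left_mono) auto
  then show ?thesis using step[OF r] by linarith
qed

text \<open>The last descent dominates the sum of all descents, with relative error of order \<open>1 / \<nu>\<close>: the mean
hitting time hardly depends on the starting level.\<close>
lemma hitting_mean_bounds:
  assumes \<nu>: "real L \<le> \<nu>" and l: "1 \<le> l" "l \<le> L"
  shows "0 < hitting_mean L \<nu> 1" "hitting_mean L \<nu> 1 \<le> hitting_mean L \<nu> l"
    "hitting_mean L \<nu> l \<le> (1 + (real L)\<^sup>2 / \<nu>) * hitting_mean L \<nu> 1"
proof -
  have pos: "0 < \<nu>" and L: "1 \<le> L" using \<nu> l by simp_all
  let ?d = "descent_mean L \<nu>"
  have nn: "0 \<le> ?d r" for r using pos by (intro descent_mean_nonneg) simp
  have "real 1 * ?d (L - 1) \<ge> 1"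
    using descent_mean_recurrence[of 1 L \<nu>] L nn pos by (auto simp: mult_nonneg_nonneg)
  then show "0 < hitting_mean L \<nu> 1" unfolding hitting_mean_1 by simp
  have split: "hitting_mean L \<nu> l = ?d (L - 1) + (\<Sum>k\<in>{2..l}. ?d (L - k))"
    unfolding hitting_mean_def using l by (subst sum.atLeast_Suc_atMost) (auto simp: numeral_2_eq_2)
  show "hitting_mean L \<nu> 1 \<le> hitting_mean L \<nu> l"
    unfolding hitting_mean_1 split using nn by (simp add: sum_nonneg)
  have "(\<Sum>k\<in>{2..l}. ?d (L - k)) \<le> (\<Sum>k\<in>{2..l}. real L / \<nu> * ?d (L - 1))"
    using \<nu> L l by (intro sum_mono descent_mean_le) auto
  also have "\<dots> = real (l - 1) * (real L / \<nu> * ?d (L - 1))" by simp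
  also have "\<dots> \<le> real L * (real L / \<nu> * ?d (L - 1))"
    using l pos nn by (intro mult_right_mono) auto
  finally show "hitting_mean L \<nu> l \<le> (1 + (real L)\<^sup>2 / \<nu>) * hitting_mean L \<nu> 1"
    unfolding hitting_mean_1 split by (simp add: power2_eq_square algebra_simps)
qed

theorem mainTheorem6:
  fixes L :: nat
    and M :: "real \<Rightarrow> 'a measure"
    and X :: "real \<Rightarrow> real \<Rightarrow> 'a \<Rightarrow> nat"
  assumes "1 \<le> L"
    and "\<And>\<nu>. 0 < \<nu> \<Longrightarrow> birth_death_process_from L (M \<nu>) L \<nu> (X \<nu>)"
  shows "weak_conv_along at_top
           (\<lambda>\<nu>. normalised_law (M \<nu>) (first_passage_time (X \<nu>) 0))
           (exponential_law 1)"
proof -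
  let ?F = "\<lambda>\<nu>. cdf (normalised_law (M \<nu>) (first_passage_time (X \<nu>) 0))"
  define c where "c \<nu> = 1 + (real L)\<^sup>2 / \<nu>" for \<nu>
  have c_lim: "(c \<longlongrightarrow> 1) at_top"
  proof -
    have "((\<lambda>\<nu>. 1 + (real L)\<^sup>2 / \<nu>) \<longlongrightarrow> 1 + 0) at_top"
      by (intro tendsto_intros tendsto_divide_0[OF tendsto_const] filterlim_at_top_imp_at_infinity filterlim_ident)
    then show ?thesis by (simp add: c_def[abs_def])
  qed
  have bounds: "(x < 0 \<longrightarrow> ?F \<nu> x = 0) \<and> (0 \<le> x \<longrightarrow>
      1 - c \<nu> * exp (- x / (c \<nu>)\<^sup>2) \<le> ?F \<nu> x \<and> ?F \<nu> x \<le> 1 - exp (- x * (c \<nu>)\<^sup>2) / c \<nu>)"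
    if \<nu>: "real L \<le> \<nu>" for \<nu> x
  proof -
    have pos: "0 < \<nu>" using \<nu> assms(1) by simp
    have bd: "finite_markov_jump_process (M \<nu>) {0..L} (bd_rate L \<nu>) (X \<nu>)"
      and start: "AE \<omega> in M \<nu>. X \<nu> 0 \<omega> = L"
      using assms(2)[OF pos] by (auto simp: birth_death_process_from_def)
    have start: "AE \<omega> in M \<nu>. X \<nu> 0 \<omega> \<noteq> 0"
      using start assms(1) by (auto elim: eventually_mono)
    have c: "1 \<le> c \<nu>" using pos by (simp add: c_def)
    have drift: "(\<Sum>j\<in>{0..L} - {i}. bd_rate L \<nu> i j * (hitting_mean L \<nu> j - hitting_mean L \<nu> i)) = - 1"
      if "i \<in> {0..L} - {0}" for i
      using that by (intro generator_hitting_mean) auto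
    have u: "hitting_mean L \<nu> 1 \<le> hitting_mean L \<nu> i \<and> hitting_mean L \<nu> i \<le> c \<nu> * hitting_mean L \<nu> 1"
      if "i \<in> {0..L} - {0}" for i
      using that hitting_mean_bounds[OF \<nu>, of i] by (auto simp: c_def)
    note * = finite_markov_jump_process.cdf_normalised_first_passage_bounds[OF bd
        hitting_mean_bounds(1)[OF \<nu> order_refl assms(1)] drift hitting_mean_0 u c start]
    show ?thesis using *(1)[of x] *(2)[of x] *(3)[of x] by (intro conjI impI)
  qed
  have ev: "\<forall>\<^sub>F \<nu> in at_top. real L \<le> \<nu>" by (rule eventually_ge_at_top)
  have "((\<lambda>\<nu>. ?F \<nu> x) \<longlongrightarrow> cdf (exponential_law 1) x) at_top" for x
  proof (cases "0 \<le> x")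
    case False
    have "\<forall>\<^sub>F \<nu> in at_top. ?F \<nu> x = 0"
      using ev by eventually_elim (use bounds False in auto)
    then show ?thesis using False by (simp add: cdf_exponential_law tendsto_eventually)
  next
    case True
    have lower: "((\<lambda>\<nu>. 1 - c \<nu> * exp (- x / (c \<nu>)\<^sup>2)) \<longlongrightarrow> 1 - 1 * exp (- x / 1\<^sup>2)) at_top"
      by (intro tendsto_intros c_lim) auto
    have upper: "((\<lambda>\<nu>. 1 - exp (- x * (c \<nu>)\<^sup>2) / c \<nu>) \<longlongrightarrow> 1 - exp (- x * 1\<^sup>2) / 1) at_top"
      by (intro tendsto_intros c_lim) auto
    have ge: "\<forall>\<^sub>F \<nu> in at_top. 1 - c \<nu> * exp (- x / (c \<nu>)\<^sup>2) \<le> ?F \<nu> x"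
      using ev by eventually_elim (use bounds[of _ x] True in blast)
    have le: "\<forall>\<^sub>F \<nu> in at_top. ?F \<nu> x \<le> 1 - exp (- x * (c \<nu>)\<^sup>2) / c \<nu>"
      using ev by eventually_elim (use bounds[of _ x] True in blast)
    have "((\<lambda>\<nu>. ?F \<nu> x) \<longlongrightarrow> 1 - exp (- x)) at_top"
      by (rule tendsto_sandwich[OF ge le]) (use lower upper in simp_all)
    then show ?thesis using True by (simp add: cdf_exponential_law)
  qed
  then show ?thesis by (simp add: weak_conv_along_def)
qed

end
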